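(* Let $N\ge 1$, let $J\in\mathbb{R}^{2N\times 2N}$ be nonsingular and skew-symmetric, and let $W\in\mathbb{R}^{2N\times 2N}$ be $J$-symplectic. If $W$ is strongly stable, then there exists a constant $\delta>0$ such that for every vector $u\in\mathbb{R}^{2N}$ with $\|uu^TJW\|<\delta$ one has $$(\widetilde{S}_0y,y)\neq\varphi(y)\quad\text{for every eigenvector } y \text{ of } W,$$ where $\widetilde{W}=(I+uu^TJ)W$, $\widetilde{S}_0=\tfrac12\left(J\widetilde{W}+(J\widetilde{W})^T\right)$ and $\varphi(y)=\tfrac12\left(\left[Juu^TJW+(Juu^TJW)^T\right]y,y\right)$.
   Context: A matrix $W\in\mathbb{R}^{2N\times 2N}$ is $J$-symplectic if $W^TJW=J$. $\|\cdot\|$ is the matrix 2-norm and $(\cdot,\cdot)$ is the Euclidean scalar product on $\mathbb{C}^{2N}$, $(x,y)=\sum_k x_k\overline{y_k}$; eigenvectors are nonzero and may be complex. A $J$-symplectic matrix $W$ is stable if its powers $W^k$, $k\in\mathbb{Z}$, are uniformly bounded in norm; it is strongly stable if there exists $\delta_0>0$ such that every $J$-symplectic $W'\in\mathbb{R}^{2N\times 2N}$ with $\|W'-W\|\le\delta_0$ is stable. *)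

theory Defs
  imports "HOL-Analysis.Analysis"
begin

definition symplectic :: "real^'n^'n \<Rightarrow> real^'n^'n \<Rightarrow> bool" where
  "symplectic J W \<longleftrightarrow> transpose W ** J ** W = J"

(* The matrix 2-norm is the norm of the Euclidean operator, hence onorm;
   the norm of the type real^'n^'n is the Frobenius norm. *)
definition mat_norm2 :: "real^'n^'n \<Rightarrow> real" where
  "mat_norm2 A = onorm (\<lambda>x. A *v x)"

(* Multiplication of the type real^'n^'n is componentwise,
   so its power operators are not the matrix powers. *)
definition mat_pow :: "real^'n^'n \<Rightarrow> nat \<Rightarrow> real^'n^'n" where
  "mat_pow A k = (((**) A) ^^ k) (mat 1)"

definition mat_powi :: "real^'n^'n \<Rightarrow> int \<Rightarrow> real^'n^'n" where
  "mat_powi A k =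
     (if k \<ge> 0 then mat_pow A (nat k) else mat_pow (matrix_inv A) (nat (- k)))"

definition stable :: "real^'n^'n \<Rightarrow> bool" where
  "stable W \<longleftrightarrow> (\<exists>C. \<forall>k::int. mat_norm2 (mat_powi W k) \<le> C)"

definition strongly_stable :: "real^'n^'n \<Rightarrow> real^'n^'n \<Rightarrow> bool" where
  "strongly_stable J W \<longleftrightarrow>
     (\<exists>\<delta>\<^sub>0>0. \<forall>W'. symplectic J W' \<longrightarrow> mat_norm2 (W' - W) \<le> \<delta>\<^sub>0 \<longrightarrow> stable W')"

definition cprod :: "complex^'n \<Rightarrow> complex^'n \<Rightarrow> complex" where
  "cprod x y = (\<Sum>k\<in>UNIV. x $ k * cnj (y $ k))"

abbreviation cmat :: "real^'n^'n \<Rightarrow> complex^'n^'n" where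
  "cmat A \<equiv> map_matrix complex_of_real A"

definition is_eigenvector :: "real^'n^'n \<Rightarrow> complex^'n \<Rightarrow> bool" where
  "is_eigenvector A y \<longleftrightarrow> y \<noteq> 0 \<and> (\<exists>\<mu>::complex. cmat A *v y = \<mu> *s y)"

definition outer :: "real^'n \<Rightarrow> real^'n^'n" where
  "outer u = (columnvector u :: real^1^'n) ** (rowvector u :: real^'n^1)"

definition W_pert :: "real^'n^'n \<Rightarrow> real^'n^'n \<Rightarrow> real^'n \<Rightarrow> real^'n^'n" where
  "W_pert J W u = (mat 1 + outer u ** J) ** W"

definition S0_pert :: "real^'n^'n \<Rightarrow> real^'n^'n \<Rightarrow> real^'n \<Rightarrow> real^'n^'n" where
  "S0_pert J W u = (1/2) *\<^sub>R (J ** W_pert J W u + transpose (J ** W_pert J W u))"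

definition phi :: "real^'n^'n \<Rightarrow> real^'n^'n \<Rightarrow> real^'n \<Rightarrow> complex^'n \<Rightarrow> complex" where
  "phi J W u y =
     (1/2) * cprod (cmat (J ** outer u ** J ** W + transpose (J ** outer u ** J ** W)) *v y) y"

end

theory Submission
  imports Defs
begin

text \<open>
  The terms depending on \<open>u\<close> cancel, so the claim is that \<open>(S\<^sub>0y, y) \<noteq> 0\<close> for
  \<open>S\<^sub>0 = (JW + (JW)\<^sup>T)/2\<close>. For \<open>y = a + ib\<close> with eigenvalue \<open>\<mu>\<close> this number equals
  \<open>-2 Im \<mu> (a \<bullet> Jb)\<close>. If it vanished, then either \<open>a, b\<close> or (when \<open>\<mu>\<close> is real) one of \<open>a\<close>, \<open>b\<close>
  alone would span a \<open>W\<close>-invariant isotropic space. A symplectic matrix close to the identity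
  can stretch an isotropic space by any factor \<open>1 + s\<close>, which moves \<open>\<mu>\<close> to \<open>(1 + s)\<mu>\<close>. As \<open>\<mu>\<close> lies on
  the unit circle, arbitrarily small symplectic perturbations of \<open>W\<close> would be unstable.
\<close>

section \<open>Symplectic matrices and the skew form\<close>

lemma matrix_inv_inverse:
  assumes "invertible A"
  shows "A ** matrix_inv A = mat 1" "matrix_inv A ** A = mat 1"
  using someI_ex[OF assms[unfolded invertible_def]] by (simp_all add: matrix_inv_def)

lemma symplectic_iff:
  "symplectic J A \<longleftrightarrow> (\<forall>x y. (A *v x) \<bullet> (J *v (A *v y)) = x \<bullet> (J *v y))"
proof -
  have "x \<bullet> ((transpose A ** J ** A) *v y) = (A *v x) \<bullet> (J *v (A *v y))" for x y
    by (metis dot_lmul_matrix matrix_vector_mul_assoc transpose_matrix_vector transpose_transpose)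
  then show ?thesis
    unfolding symplectic_def matrix_eq by (metis vector_eq_rdot inner_commute)
qed

lemma skew_form:
  fixes J :: "real^'n^'n"
  assumes "transpose J = - J"
  shows "x \<bullet> (J *v y) = - (y \<bullet> (J *v x))"
proof -
  have "x \<bullet> (J *v y) = (transpose J *v x) \<bullet> y"
    by (simp add: dot_lmul_matrix)
  also have "transpose J *v x = - (J *v x)"
    unfolding assms using matrix_vector_mult_diff_rdistrib[of 0 J x] by simp
  also have "\<dots> \<bullet> y = - (y \<bullet> (J *v x))"
    by (simp add: inner_commute)
  finally show ?thesis .
qed

text \<open>A vector killed by \<open>A\<close> pairs to zero with every vector under the form, and
  \<open>J\<close> makes the form nondegenerate.\<close>

lemma symplectic_invertible:
  fixes J :: "real^'n^'n"
  assumes "invertible J" "symplectic J A"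
  shows "invertible A"
proof -
  have "A *v x = 0 \<Longrightarrow> x = 0" for x
  proof -
    assume "A *v x = 0"
    then have "y \<bullet> (J *v x) = 0" for y
      using assms(2) unfolding symplectic_iff by (metis inner_zero_right matrix_vector_mult_0_right)
    then have "J *v x = 0"
      using inner_eq_zero_iff by blast
    then show "x = 0"
      using assms(1) by (metis invertible_def matrix_left_invertible_ker)
  qed
  then show ?thesis
    by (metis invertible_left_inverse matrix_left_invertible_ker)
qed

section \<open>Symplectic stretching of isotropic subspaces\<close>

text \<open>\<open>P\<close> projects onto \<open>L\<close>, and \<open>Q\<close> is its adjoint for
  the form, projecting onto an isotropic space dual to \<open>L\<close>. Stretching \<open>L\<close>
  then only needs a compensating contraction of that dual space.\<close>

lemma isotropic_projection_pair:
  fixes J :: "real^'n^'n"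
  assumes J: "invertible J" "transpose J = - J"
    and L: "subspace L" "\<forall>x\<in>L. \<forall>y\<in>L. x \<bullet> (J *v y) = 0"
  obtains P Q :: "real^'n^'n"
  where "\<And>x. x \<in> L \<Longrightarrow> P *v x = x" "\<And>x. x \<in> L \<Longrightarrow> Q *v x = 0"
    and "\<And>x. P *v (P *v x) = P *v x"
    and "\<And>x y. (P *v x) \<bullet> (J *v y) = x \<bullet> (J *v (Q *v y))"
    and "\<And>x y. (P *v x) \<bullet> (J *v (P *v y)) = 0"
    and "\<And>x y. (Q *v x) \<bullet> (J *v (Q *v y)) = 0"
proof -
  obtain B where B: "B \<subseteq> L" "independent B" "L \<subseteq> span B"
    by (metis basis_exists)
  have "span B = L"
    using span_minimal[OF B(1) L(1)] B(3) by (rule subset_antisym)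
  \<comment> \<open>Extending the identity of \<open>B\<close> with range inside its span gives a
    projection onto \<open>L\<close>.\<close>
  obtain g where g: "linear g" "\<forall>x\<in>B. g x = id x" "range g = span (id ` B)"
    using linear_independent_extend_subspace[OF B(2)] by blast
  define P where "P = matrix g"
  have Pg: "P *v x = g x" for x
    by (simp add: P_def g(1) matrix_works)
  have PL: "P *v x \<in> L" for x
    using g(3) \<open>span B = L\<close> by (auto simp: Pg)
  have Pid: "P *v x = x" if "x \<in> L" for x
    using linear_eq_on[OF g(1) linear_id, of x B] that B(3) g(2) by (auto simp: Pg)
  \<comment> \<open>Solving \<open>\<omega> (P *v x) y = \<omega> x (Q *v y)\<close> for
    \<open>Q\<close> gives this conjugate of the transpose.\<close>
  define Q where "Q = matrix_inv J ** transpose P ** J"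
  define \<omega> where "\<omega> x y = x \<bullet> (J *v y)" for x y
  have bil: "\<omega> (x + x') y = \<omega> x y + \<omega> x' y" "\<omega> x (y + y') = \<omega> x y + \<omega> x y'"
    "\<omega> (x - x') y = \<omega> x y - \<omega> x' y" "\<omega> x (y - y') = \<omega> x y - \<omega> x y'"
    "\<omega> (c *\<^sub>R x) y = c * \<omega> x y" "\<omega> x (c *\<^sub>R y) = c * \<omega> x y" for x x' y y' c
    by (simp_all add: \<omega>_def inner_add inner_diff matrix_vector_right_distrib
        matrix_vector_mult_diff_distrib matrix_vector_mult_scaleR)
  have skew: "\<omega> x y = - \<omega> y x" for x y
    unfolding \<omega>_def using J(2) by (rule skew_form)
  have JQ: "J *v (Q *v y) = transpose P *v (J *v y)" for y
    unfolding Q_def using J(1)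
    by (metis matrix_inv_inverse(1) matrix_mul_assoc matrix_mul_lid matrix_vector_mul_assoc)
  have PQ: "\<omega> (P *v x) y = \<omega> x (Q *v y)" for x y
    unfolding \<omega>_def JQ by (metis dot_lmul_matrix transpose_matrix_vector transpose_transpose)
  have QP: "\<omega> (Q *v x) y = \<omega> x (P *v y)" for x y
    by (metis PQ skew)
  have PP: "P *v (P *v x) = P *v x" for x
    using PL Pid by blast
  have Q0: "Q *v x = 0" if "x \<in> L" for x
  proof -
    have "\<omega> z (Q *v x) = 0" for z
      using PQ L(2)[rule_format] PL that unfolding \<omega>_def by metis
    then have "J *v (Q *v x) = 0"
      unfolding \<omega>_def using inner_eq_zero_iff by blast
    then show ?thesis
      using J(1) by (metis invertible_def matrix_left_invertible_ker)
  qed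
  have QPP: "Q *v (P *v x) = 0" for x
    using Q0 PL by blast
  \<comment> \<open>The range of \<open>Q\<close> need not be isotropic; subtracting \<open>PQ/2\<close> from both \<open>P\<close> and \<open>Q\<close> repairs this.\<close>
  define P1 where "P1 = P - (1/2) *\<^sub>R (P ** Q)"
  define Q1 where "Q1 = Q - (1/2) *\<^sub>R (P ** Q)"
  have P1: "P1 *v x = P *v x - (1/2) *\<^sub>R (P *v (Q *v x))" for x
    by (simp add: P1_def matrix_vector_mult_diff_rdistrib matrix_vector_mul_assoc
        flip: scaleR_matrix_vector_assoc)
  have Q1: "Q1 *v x = Q *v x - (1/2) *\<^sub>R (P *v (Q *v x))" for x
    by (simp add: Q1_def matrix_vector_mult_diff_rdistrib matrix_vector_mul_assoc
        flip: scaleR_matrix_vector_assoc)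
  \<comment> \<open>\<open>P ** Q\<close> is its own adjoint, so \<open>Q1\<close> is the adjoint of
    \<open>P1\<close>. In \<open>\<omega> (Q1 *v x) (Q1 *v y)\<close> each of the two cross terms
    removes half of \<open>\<omega> (Q *v x) (Q *v y)\<close>, hence the factor 1/2.\<close>
  have QQ: "\<omega> (P *v (Q *v x)) y = \<omega> (Q *v x) (Q *v y)"
    "\<omega> x (P *v (Q *v y)) = \<omega> (Q *v x) (Q *v y)"
    "\<omega> (Q *v x) (Q *v (Q *v y)) = \<omega> (Q *v x) (Q *v y)"
    "\<omega> (Q *v (Q *v x)) (Q *v y) = \<omega> (Q *v x) (Q *v y)" for x y
    by (metis PQ QP PP)+
  show ?thesis
  proof
    show "P1 *v x = x" "Q1 *v x = 0" if "x \<in> L" for x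
      using that by (simp_all add: P1 Q1 Pid Q0)
    show "P1 *v (P1 *v x) = P1 *v x" for x
      by (simp add: P1 PP QPP matrix_vector_mult_diff_distrib matrix_vector_mult_scaleR)
    show "(P1 *v x) \<bullet> (J *v y) = x \<bullet> (J *v (Q1 *v y))" for x y
      unfolding \<omega>_def[symmetric] by (simp add: P1 Q1 bil PQ[of x y] QQ(1,2))
    show "(P1 *v x) \<bullet> (J *v (P1 *v y)) = 0" for x y
      unfolding P1 by (intro L(2)[rule_format] subspace_diff[OF L(1)] subspace_scale[OF L(1)] PL)
    have "\<omega> 0 x = 0" for x
      by (simp add: \<omega>_def)
    then show "(Q1 *v x) \<bullet> (J *v (Q1 *v y)) = 0" for x y
      unfolding \<omega>_def[symmetric] Q1 bil by (simp add: QQ QPP)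
  qed
qed

text \<open>Isotropy of both ranges removes the terms in \<open>s * s\<close> and
  \<open>r * r\<close>. By adjointness and idempotence all others collect with the factor
  \<open>s + r + s * r\<close>, which is \<open>(1 + s) * (1 + r) - 1\<close>.\<close>

lemma symplectic_stretch:
  fixes J P Q :: "real^'n^'n" and s r :: real
  assumes skew: "transpose J = - J"
    and PP: "\<And>x. P *v (P *v x) = P *v x"
    and PQ: "\<And>x y. (P *v x) \<bullet> (J *v y) = x \<bullet> (J *v (Q *v y))"
    and P0: "\<And>x y. (P *v x) \<bullet> (J *v (P *v y)) = 0"
    and Q0: "\<And>x y. (Q *v x) \<bullet> (J *v (Q *v y)) = 0"
    and sr: "(1 + s) * (1 + r) = 1"
  shows "symplectic J (mat 1 + s *\<^sub>R P + r *\<^sub>R Q)"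
  unfolding symplectic_iff
proof (intro allI)
  fix x y :: "real^'n"
  define \<omega> where "\<omega> x y = x \<bullet> (J *v y)" for x y
  have bil: "\<omega> (x + x') y = \<omega> x y + \<omega> x' y" "\<omega> x (y + y') = \<omega> x y + \<omega> x y'"
    "\<omega> (c *\<^sub>R x) y = c * \<omega> x y" "\<omega> x (c *\<^sub>R y) = c * \<omega> x y" for x x' y y' c
    by (simp_all add: \<omega>_def inner_add matrix_vector_right_distrib matrix_vector_mult_scaleR)
  have skew: "\<omega> x y = - \<omega> y x" for x y
    unfolding \<omega>_def using skew by (rule skew_form)
  have 1: "\<omega> (P *v x) y = \<omega> x (Q *v y)" for x y
    using PQ by (simp add: \<omega>_def)
  have 2: "\<omega> (Q *v x) y = \<omega> x (P *v y)" for x y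
    by (metis 1 skew)
  have 3: "\<omega> x (Q *v (Q *v y)) = \<omega> x (Q *v y)" "\<omega> x (P *v (P *v y)) = \<omega> x (P *v y)" for x y
    by (metis 1 2 PP)+
  have 4: "\<omega> x (Q *v (P *v y)) = 0" "\<omega> x (P *v (Q *v y)) = 0"
    using P0 Q0 1 2 unfolding \<omega>_def by metis+
  let ?M = "mat 1 + s *\<^sub>R P + r *\<^sub>R Q"
  have M: "?M *v x = x + s *\<^sub>R (P *v x) + r *\<^sub>R (Q *v x)" for x
    by (simp add: matrix_vector_mult_add_rdistrib flip: scaleR_matrix_vector_assoc)
  have "\<omega> (?M *v x) (?M *v y) = \<omega> x y + (s + r + s * r) * (\<omega> x (P *v y) + \<omega> x (Q *v y))"
    unfolding M bil 1 2 3 4 by (simp add: algebra_simps)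
  also have "s + r + s * r = 0"
    using sr by (simp add: algebra_simps)
  finally show "(?M *v x) \<bullet> (J *v (?M *v y)) = x \<bullet> (J *v y)"
    by (simp add: \<omega>_def)
qed

section \<open>Eigenvalues of stable matrices\<close>

text \<open>\<open>eigenpair A \<mu> a b\<close> is the equation \<open>A(a + ib) = \<mu>(a + ib)\<close> split into real and imaginary parts.\<close>

definition eigenpair :: "real^'n^'n \<Rightarrow> complex \<Rightarrow> real^'n \<Rightarrow> real^'n \<Rightarrow> bool" where
  "eigenpair A \<mu> a b \<longleftrightarrow>
     A *v a = Re \<mu> *\<^sub>R a - Im \<mu> *\<^sub>R b \<and> A *v b = Im \<mu> *\<^sub>R a + Re \<mu> *\<^sub>R b"

lemma eigenpair_mult:
  assumes "eigenpair A \<mu> a b" "eigenpair B \<nu> a b"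
  shows "eigenpair (A ** B) (\<mu> * \<nu>) a b"
proof -
  have A: "A *v a = Re \<mu> *\<^sub>R a - Im \<mu> *\<^sub>R b" "A *v b = Im \<mu> *\<^sub>R a + Re \<mu> *\<^sub>R b"
    and B: "B *v a = Re \<nu> *\<^sub>R a - Im \<nu> *\<^sub>R b" "B *v b = Im \<nu> *\<^sub>R a + Re \<nu> *\<^sub>R b"
    using assms by (auto simp: eigenpair_def)
  show ?thesis
    unfolding eigenpair_def matrix_vector_mul_assoc[symmetric] B matrix_vector_right_distrib
      matrix_vector_mult_diff_distrib matrix_vector_mult_scaleR A
    by (simp add: algebra_simps)
qed

lemma eigenpair_mat_pow:
  assumes "eigenpair A \<mu> a b"
  shows "eigenpair (mat_pow A k) (\<mu> ^ k) a b"
proof (induction k)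
  case 0
  show ?case
    by (simp add: mat_pow_def eigenpair_def)
next
  case (Suc k)
  then show ?case
    using eigenpair_mult[OF assms] by (simp add: mat_pow_def)
qed

lemma eigenpair_inverse:
  assumes "eigenpair A \<mu> a b" "invertible A" "\<mu> \<noteq> 0"
  shows "eigenpair (matrix_inv A) (inverse \<mu>) a b"
proof -
  let ?V = "matrix_inv A"
  define d where "d = (Re \<mu>)\<^sup>2 + (Im \<mu>)\<^sup>2"
  have d: "d \<noteq> 0"
    using assms(3) by (simp add: d_def complex_eq_iff sum_power2_eq_zero_iff)
  have V: "?V *v (A *v x) = x" for x
    using assms(2) by (simp add: matrix_vector_mul_assoc matrix_inv_inverse)
  have A: "A *v a = Re \<mu> *\<^sub>R a - Im \<mu> *\<^sub>R b" "A *v b = Im \<mu> *\<^sub>R a + Re \<mu> *\<^sub>R b"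
    using assms(1) by (auto simp: eigenpair_def)
  \<comment> \<open>The inverse of \<open>\<mu>\<close> is its conjugate over \<open>d\<close>, the
    squared modulus. The vectors here and below are the real and imaginary parts of the conjugate
    times a + ib.\<close>
  have "A *v (Re \<mu> *\<^sub>R a + Im \<mu> *\<^sub>R b) = d *\<^sub>R a"
    by (simp only: matrix_vector_right_distrib matrix_vector_mult_scaleR A)
      (simp add: d_def algebra_simps power2_eq_square)
  then have "A *v ((1 / d) *\<^sub>R (Re \<mu> *\<^sub>R a + Im \<mu> *\<^sub>R b)) = a"
    unfolding matrix_vector_mult_scaleR using d by simp
  then have 1: "?V *v a = (1 / d) *\<^sub>R (Re \<mu> *\<^sub>R a + Im \<mu> *\<^sub>R b)"
    using V by metis
  have "A *v (Re \<mu> *\<^sub>R b - Im \<mu> *\<^sub>R a) = d *\<^sub>R b"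
    by (simp only: matrix_vector_mult_diff_distrib matrix_vector_mult_scaleR A)
      (simp add: d_def algebra_simps power2_eq_square)
  then have "A *v ((1 / d) *\<^sub>R (Re \<mu> *\<^sub>R b - Im \<mu> *\<^sub>R a)) = b"
    unfolding matrix_vector_mult_scaleR using d by simp
  then have 2: "?V *v b = (1 / d) *\<^sub>R (Re \<mu> *\<^sub>R b - Im \<mu> *\<^sub>R a)"
    using V by metis
  show ?thesis
    unfolding eigenpair_def 1 2 by (simp add: d_def algebra_simps)
qed

lemma mat_norm2_nonneg: "mat_norm2 A \<ge> 0"
  unfolding mat_norm2_def by (intro onorm_pos_le matrix_vector_mul_bounded_linear)

lemma norm_mat_vec_le: "norm (A *v x) \<le> mat_norm2 A * norm x"
  unfolding mat_norm2_def by (rule onorm) (rule matrix_vector_mul_bounded_linear)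

text \<open>\<open>mat_norm2\<close> sees real vectors only. Bounding both parts separately and
  adding squares reaches complex eigenvectors, since the mixed inner products cancel in the
  sum.\<close>

lemma eigenpair_norm_le:
  assumes "eigenpair A \<mu> a b" "a \<noteq> 0 \<or> b \<noteq> 0"
  shows "cmod \<mu> \<le> mat_norm2 A"
proof -
  have A: "A *v a = Re \<mu> *\<^sub>R a - Im \<mu> *\<^sub>R b" "A *v b = Im \<mu> *\<^sub>R a + Re \<mu> *\<^sub>R b"
    using assms(1) by (auto simp: eigenpair_def)
  have "(cmod \<mu>)\<^sup>2 * ((norm a)\<^sup>2 + (norm b)\<^sup>2) = (norm (A *v a))\<^sup>2 + (norm (A *v b))\<^sup>2"
    unfolding A cmod_power2 unfolding power2_norm_eq_inner
    by (simp add: inner_add inner_diff inner_commute algebra_simps power2_eq_square)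
  also have "\<dots> \<le> (mat_norm2 A * norm a)\<^sup>2 + (mat_norm2 A * norm b)\<^sup>2"
    by (intro add_mono power_mono norm_mat_vec_le norm_ge_zero)
  also have "\<dots> = (mat_norm2 A)\<^sup>2 * ((norm a)\<^sup>2 + (norm b)\<^sup>2)"
    by (simp add: algebra_simps power_mult_distrib)
  finally have "(cmod \<mu>)\<^sup>2 \<le> (mat_norm2 A)\<^sup>2"
    using assms(2) by (auto simp: mult_le_cancel_right add_pos_nonneg add_nonneg_pos)
  then show ?thesis
    using mat_norm2_nonneg power2_le_imp_le by blast
qed

lemma power_bounded_imp_eigenvalue_le_1:
  assumes "eigenpair A \<mu> a b" "a \<noteq> 0 \<or> b \<noteq> 0" "\<And>k. mat_norm2 (mat_pow A k) \<le> C"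
  shows "cmod \<mu> \<le> 1"
proof (rule ccontr)
  assume "\<not> cmod \<mu> \<le> 1"
  then obtain k where "C < cmod \<mu> ^ k"
    using real_arch_pow[of "cmod \<mu>" C] by auto
  also have "\<dots> \<le> mat_norm2 (mat_pow A k)"
    using eigenpair_norm_le[OF eigenpair_mat_pow[OF assms(1)] assms(2)] by (simp add: norm_power)
  finally show False
    using assms(3)[of k] by simp
qed

text \<open>Bounded positive powers put \<open>\<mu>\<close> in the closed unit disc; bounded
  negative powers do the same for its inverse.\<close>

lemma stable_imp_eigenvalue_unit:
  assumes "stable A" "invertible A" "eigenpair A \<mu> a b" "a \<noteq> 0 \<or> b \<noteq> 0"
  shows "cmod \<mu> = 1"
proof -
  obtain C where C: "mat_norm2 (mat_powi A k) \<le> C" for k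
    using assms(1) unfolding stable_def by blast
  have pos: "mat_norm2 (mat_pow A k) \<le> C" for k
    using C[of "int k"] by (simp add: mat_powi_def)
  have neg: "mat_norm2 (mat_pow (matrix_inv A) k) \<le> C" for k
    \<comment> \<open>At exponent 0 \<open>mat_powi\<close> takes the nonnegative branch; both
      powers are then the identity.\<close>
    using C[of "- int k"] by (cases "k = 0") (auto simp: mat_powi_def mat_pow_def)
  have "\<mu> \<noteq> 0"
  proof
    assume "\<mu> = 0"
    then have "A *v a = 0" "A *v b = 0"
      using assms(3) by (simp_all add: eigenpair_def)
    then show False
      using assms(2,4) by (metis invertible_def matrix_left_invertible_ker)
  qed
  then have "cmod (inverse \<mu>) \<le> 1"
    using power_bounded_imp_eigenvalue_le_1[OF eigenpair_inverse] assms neg by blast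
  moreover have "cmod \<mu> \<le> 1"
    using power_bounded_imp_eigenvalue_le_1 assms pos by blast
  ultimately show ?thesis
    using \<open>\<mu> \<noteq> 0\<close> by (simp add: norm_inverse one_le_inverse_iff inverse_le_1_iff)
qed

section \<open>Strong stability excludes isotropic eigenvectors\<close>

text \<open>For y = a + ib, (Jy, y) is 2i times \<open>a \<bullet> (J *v b)\<close>: the Krein form
  does not vanish on eigenvectors. Allowing \<open>a = 0\<close> or \<open>b = 0\<close> lets this
  also exclude real eigenvalues.\<close>

lemma strongly_stable_no_isotropic_eigenpair:
  fixes J W :: "real^'n^'n"
  assumes J: "invertible J" "transpose J = - J"
    and W: "symplectic J W" "strongly_stable J W"
    and ep: "eigenpair W \<mu> a b" "a \<noteq> 0 \<or> b \<noteq> 0"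
  shows "a \<bullet> (J *v b) \<noteq> 0"
proof
  assume ab: "a \<bullet> (J *v b) = 0"
  obtain \<delta> where \<delta>: "\<delta> > 0"
    "\<And>W'. symplectic J W' \<Longrightarrow> mat_norm2 (W' - W) \<le> \<delta> \<Longrightarrow> stable W'"
    using W(2) unfolding strongly_stable_def by blast
  \<comment> \<open>\<open>W\<close> lies in its own neighbourhood, so it is stable itself.\<close>
  have "mat_norm2 (W - W) = 0"
    by (simp add: mat_norm2_def onorm_zero)
  then have unit: "cmod \<mu> = 1"
    using \<delta> W(1) J ep by (metis less_imp_le stable_imp_eigenvalue_unit symplectic_invertible)
  define L where "L = span {a, b}"
  have self: "x \<bullet> (J *v x) = 0" for x
    using skew_form[OF J(2), of x x] by simp
  have comb: "\<exists>p q. x = p *\<^sub>R a + q *\<^sub>R b" if "x \<in> L" for x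
  proof -
    obtain p q where "x - p *\<^sub>R a = q *\<^sub>R b"
      using \<open>x \<in> L\<close> unfolding L_def span_breakdown_eq[of x a "{b}"] span_singleton by auto
    then have "x = p *\<^sub>R a + q *\<^sub>R b"
      by (simp add: diff_eq_eq add.commute)
    then show ?thesis
      by blast
  qed
  have "subspace L"
    by (simp add: L_def)
  moreover have "\<forall>x\<in>L. \<forall>y\<in>L. x \<bullet> (J *v y) = 0"
  proof (intro ballI)
    fix x y
    assume "x \<in> L" "y \<in> L"
    then obtain p q p' q' where "x = p *\<^sub>R a + q *\<^sub>R b" "y = p' *\<^sub>R a + q' *\<^sub>R b"
      using comb by blast
    then show "x \<bullet> (J *v y) = 0"
      using ab skew_form[OF J(2), of b a]
      by (simp add: matrix_vector_right_distrib matrix_vector_mult_scaleR inner_add self)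
  qed
  ultimately obtain P Q where PL: "\<And>x. x \<in> L \<Longrightarrow> P *v x = x" and QL: "\<And>x. x \<in> L \<Longrightarrow> Q *v x = 0"
    and PQ: "\<And>x. P *v (P *v x) = P *v x"
      "\<And>x y. (P *v x) \<bullet> (J *v y) = x \<bullet> (J *v (Q *v y))"
      "\<And>x y. (P *v x) \<bullet> (J *v (P *v y)) = 0"
      "\<And>x y. (Q *v x) \<bullet> (J *v (Q *v y)) = 0"
    by (rule isotropic_projection_pair[OF J]) blast
  \<comment> \<open>With \<open>\<bar>r\<bar> \<le> s\<close>, the perturbation has norm at most
    \<open>s * K\<close>. Dividing by \<open>K + 1\<close> keeps this below \<open>\<delta>\<close>
    even if \<open>K = 0\<close>; \<open>r\<close> is the contraction that compensates
    \<open>s\<close>.\<close>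
  define K where "K = mat_norm2 (P ** W) + mat_norm2 (Q ** W)"
  have K: "K \<ge> 0"
    by (simp add: K_def mat_norm2_nonneg)
  define s where "s = \<delta> / (K + 1)"
  define r where "r = - s / (1 + s)"
  have s: "s > 0" "s * K \<le> \<delta>"
    using K \<delta>(1) by (simp_all add: s_def divide_simps)
  have r: "\<bar>r\<bar> \<le> s" "(1 + s) * (1 + r) = 1"
    using s(1) by (simp_all add: r_def divide_simps)
  define M where "M = mat 1 + s *\<^sub>R P + r *\<^sub>R Q"
  have M: "M *v x = x + s *\<^sub>R (P *v x) + r *\<^sub>R (Q *v x)" for x
    by (simp add: M_def matrix_vector_mult_add_rdistrib flip: scaleR_matrix_vector_assoc)
  have "symplectic J M"
    unfolding M_def using J(2) PQ r(2) by (rule symplectic_stretch)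
  then have MW: "symplectic J (M ** W)"
    using W(1) by (simp add: symplectic_iff flip: matrix_vector_mul_assoc)
  have "mat_norm2 (M ** W - W) \<le> s * K"
    unfolding mat_norm2_def
  proof (rule onorm_le)
    fix x :: "real^'n"
    have "(M ** W - W) *v x = s *\<^sub>R ((P ** W) *v x) + r *\<^sub>R ((Q ** W) *v x)"
      by (simp add: matrix_vector_mult_diff_rdistrib M flip: matrix_vector_mul_assoc)
    also have "norm \<dots> \<le> s * norm ((P ** W) *v x) + \<bar>r\<bar> * norm ((Q ** W) *v x)"
      by (rule order_trans[OF norm_triangle_ineq]) (use s in simp)
    also have "\<dots> \<le> s * (mat_norm2 (P ** W) * norm x) + s * (mat_norm2 (Q ** W) * norm x)"
      using s r mat_norm2_nonneg by (intro add_mono mult_mono norm_mat_vec_le) auto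
    also have "\<dots> = s * K * norm x"
      by (simp add: K_def algebra_simps)
    finally show "norm ((M ** W - W) *v x) \<le> s * K * norm x" .
  qed
  then have "stable (M ** W)"
    using \<delta>(2) MW s(2) by simp
  \<comment> \<open>On \<open>L\<close>, \<open>P\<close> is the identity and \<open>Q\<close>
    vanishes, so \<open>M\<close> acts there as the scalar \<open>1 + s\<close>.\<close>
  moreover have "eigenpair M (complex_of_real (1 + s)) a b"
    using PL QL by (simp add: eigenpair_def M L_def span_base algebra_simps)
  then have "eigenpair (M ** W) (complex_of_real (1 + s) * \<mu>) a b"
    using ep(1) by (rule eigenpair_mult)
  ultimately have "cmod (complex_of_real (1 + s) * \<mu>) = 1"
    using MW J(1) ep(2) stable_imp_eigenvalue_unit symplectic_invertible by blast
  then have "\<bar>1 + s\<bar> = 1"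
    unfolding norm_mult unit norm_of_real by simp
  then show False
    using s(1) by simp
qed

section \<open>Complex quadratic forms and the conclusion\<close>

lemma cmat_mult_vec:
  "(cmat A *v y) $ i = Complex ((A *v (\<chi> k. Re (y $ k))) $ i) ((A *v (\<chi> k. Im (y $ k))) $ i)"
  by (simp add: complex_eq_iff matrix_vector_mult_def map_matrix_def)

text \<open>For real \<open>A\<close> the products mixing real and imaginary parts of
  \<open>y\<close> are purely imaginary.\<close>

lemma Re_cprod_cmat:
  "Re (cprod (cmat A *v y) y) =
     (\<chi> k. Re (y $ k)) \<bullet> (A *v (\<chi> k. Re (y $ k))) + (\<chi> k. Im (y $ k)) \<bullet> (A *v (\<chi> k. Im (y $ k)))"
  by (simp add: cprod_def cmat_mult_vec inner_vec_def sum.distrib mult.commute)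

lemma inner_transpose_self:
  fixes A :: "real^'n^'n"
  shows "x \<bullet> (transpose A *v x) = x \<bullet> (A *v x)"
  by (metis dot_lmul_matrix inner_commute transpose_matrix_vector)

theorem proposition15:
  fixes N :: nat and J W :: "real^'n^'n"
  assumes "N \<ge> 1" and "CARD('n) = 2 * N"
    and "invertible J" and "transpose J = - J"
    and "symplectic J W"
    and "strongly_stable J W"
  shows "\<exists>\<delta>>0. \<forall>u :: real^'n. mat_norm2 (outer u ** J ** W) < \<delta> \<longrightarrow>
           (\<forall>y. is_eigenvector W y \<longrightarrow> cprod (cmat (S0_pert J W u) *v y) y \<noteq> phi J W u y)"
proof -
  have "cprod (cmat (S0_pert J W u) *v y) y \<noteq> phi J W u y" if y: "is_eigenvector W y" for u y
  proof
    assume eq: "cprod (cmat (S0_pert J W u) *v y) y = phi J W u y"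
    define a b where "a = (\<chi> k. Re (y $ k))" and "b = (\<chi> k. Im (y $ k))"
    obtain \<mu> where \<mu>: "cmat W *v y = \<mu> *s y" and "y \<noteq> 0"
      using y unfolding is_eigenvector_def by blast
    have nz: "a \<noteq> 0 \<or> b \<noteq> 0"
      using \<open>y \<noteq> 0\<close> by (auto simp: a_def b_def vec_eq_iff complex_eq_iff)
    have "Complex ((W *v a) $ i) ((W *v b) $ i) = \<mu> * y $ i" for i
      using arg_cong[OF \<mu>, of "\<lambda>v. v $ i"] by (simp add: cmat_mult_vec a_def b_def)
    then have ep: "eigenpair W \<mu> a b"
      by (auto simp: eigenpair_def vec_eq_iff complex_eq_iff a_def b_def)
    define X where "X = J ** outer u ** J ** W"
    have JW: "J ** W_pert J W u = J ** W + X"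
      by (simp add: W_pert_def X_def matrix_eq matrix_vector_mult_add_rdistrib
        matrix_vector_right_distrib flip: matrix_vector_mul_assoc)
    \<comment> \<open>Symmetrizing a real matrix leaves its real quadratic form unchanged.\<close>
    have quad: "c \<bullet> (S0_pert J W u *v c) = c \<bullet> (J *v (W *v c)) + c \<bullet> (X *v c)" for c
      unfolding S0_pert_def JW
      by (simp add: matrix_vector_mult_add_rdistrib inner_add inner_transpose_self
          matrix_vector_mul_assoc del: transpose_matrix_vector flip: scaleR_matrix_vector_assoc)
    have quad': "c \<bullet> ((X + transpose X) *v c) = 2 * (c \<bullet> (X *v c))" for c
      by (simp add: matrix_vector_mult_add_rdistrib inner_add inner_transpose_self
          del: transpose_matrix_vector)
    \<comment> \<open>Real parts suffice for a contradiction. Both sides contain the same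
      contribution of \<open>X\<close>.\<close>
    have "Re (phi J W u y) = a \<bullet> (X *v a) + b \<bullet> (X *v b)"
      unfolding phi_def X_def[symmetric]
      using Re_cprod_cmat[of "X + transpose X" y] unfolding a_def[symmetric] b_def[symmetric] quad'
      by simp
    moreover have "Re (cprod (cmat (S0_pert J W u) *v y) y) =
        a \<bullet> (J *v (W *v a)) + b \<bullet> (J *v (W *v b)) + (a \<bullet> (X *v a) + b \<bullet> (X *v b))"
      using Re_cprod_cmat[of "S0_pert J W u" y] unfolding a_def[symmetric] b_def[symmetric] quad
      by simp
    ultimately have "a \<bullet> (J *v (W *v a)) + b \<bullet> (J *v (W *v b)) = 0"
      using eq by simp
    moreover have self: "c \<bullet> (J *v c) = 0" for c
      using skew_form[OF assms(4), of c c] by simp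
    ultimately have "Im \<mu> * (a \<bullet> (J *v b)) = 0"
      using ep skew_form[OF assms(4), of b a]
      by (simp add: eigenpair_def matrix_vector_right_distrib matrix_vector_mult_diff_distrib
          matrix_vector_mult_scaleR inner_add inner_diff)
    moreover note no_iso = strongly_stable_no_isotropic_eigenpair[OF assms(3-6)]
    have "a \<bullet> (J *v b) \<noteq> 0"
      using no_iso[OF ep nz] .
    ultimately have "Im \<mu> = 0"
      by simp
    \<comment> \<open>For real \<open>\<mu>\<close> both parts of \<open>y\<close> satisfy the
      eigenvalue equation alone. One is nonzero, and its pairing with 0 vanishes.\<close>
    then have "eigenpair W \<mu> a 0" "eigenpair W \<mu> 0 b"
      using ep by (simp_all add: eigenpair_def)
    then show False
      using no_iso nz by (metis inner_zero_left inner_zero_right matrix_vector_mult_0_right)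
  qed
  then show ?thesis
    \<comment> \<open>As the terms in \<open>u\<close> cancel, any positive witness serves.\<close>
    by (intro exI[of _ 1]) simp
qed

end
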